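(* Suppose that the Regularity assumption, the Parameter assumption and the Localization assumption of the context hold, and run NR-LALM from $(x_0,\lambda_0)$. Then NR-LALM is well defined for every $k$, $[x_k,x_{k+1}]\subset\mathcal U$ for every $k\ge0$, and $$\|p_k\|\le\Delta,\quad \|\lambda_k\|\le\Lambda,\quad x_k\in\mathcal S_{\mathrm{det}}\quad(k\ge0),\qquad \Phi_k\le\overline\Phi_1\quad(k\ge1).$$
   Context: Norms are Euclidean for vectors and spectral for matrices; for $f:\mathbb R^n\to\mathbb R$, $c:\mathbb R^n\to\mathbb R^m$, $\nabla c(x):=(\nabla c_1(x),\ldots,\nabla c_m(x))\in\mathbb R^{n\times m}$. The augmented Lagrangian is $\mathcal L_\rho(x,\lambda):=f(x)+\langle\lambda,c(x)\rangle+\frac{\rho}{2}\|c(x)\|^2$. Regularity assumption: $f$ and $c$ are continuously differentiable on a nonempty open set $\mathcal U\subseteq\mathbb R^n$, and there are $\underline f\in\mathbb R$ and positive constants $G,L_f,M,L_c,\sigma$ such that for all $x,y\in\mathcal U$ and $u\in\mathbb R^m$: (i) $f(x)\ge\underline f$, $\|\nabla f(x)\|\le G$, $\|\nabla f(x)-\nabla f(y)\|\le L_f\|x-y\|$; (ii) $\|\nabla c(x)\|\le M$, $\|\nabla c(x)-\nabla c(y)\|\le L_c\|x-y\|$; (iii) $\|\nabla c(x)u\|\ge\sigma\|u\|$. Constants: $\kappa_{\mathrm{lin}}:=L_c/2$ and, for $\beta,\rho,\Delta,\Lambda>0$, $$C_{\mathrm{mod}}:=\frac{L_f}{2}+\kappa_{\mathrm{lin}}(3\Lambda+\rho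 M\Delta)+\frac{\rho}{2}\kappa_{\mathrm{lin}}^2\Delta^2,\quad A_p:=\beta+\rho M\kappa_{\mathrm{lin}}\Delta,\quad B_p:=A_p+L_f+L_c\Lambda,\quad C_{\lambda,p}:=\frac{4}{\sigma^2}\max\{A_p^2,B_p^2\}.$$ Parameter assumption: the fixed constants $\beta,\rho,\Delta,\Lambda>0$ satisfy $$\Lambda\ge\frac{G+\beta\Delta+\rho M\kappa_{\mathrm{lin}}\Delta^2}{\sigma},\quad \frac{G}{\beta}+\frac{3M\Lambda}{\beta+\rho\sigma^2}\le\Delta,\quad C_{\mathrm{mod}}\le\frac{3\beta}{8},\quad \rho\ge\frac{8C_{\lambda,p}}{\beta},$$ and the initial pair satisfies $\|\lambda_0\|\le\Lambda$ and $\rho\|c(x_0)\|\le\Lambda$. NR-LALM (deterministic): from $(x_0,\lambda_0)\in\mathbb R^n\times\mathbb R^m$, for $k=0,1,2,\ldots$, $p_k$ is the solution of $$(\beta I_n+\rho\nabla c(x_k)\nabla c(x_k)^\top)p_k=-\nabla f(x_k)-\nabla c(x_k)(\lambda_k+\rho c(x_k)),$$ and $x_{k+1}=x_k+p_k$, $\lambda_{k+1}=\lambda_k+\rho c(x_{k+1})$. Localization: let $$\overline\Phi_1:=f(x_0)+G\Delta+\frac{4\Lambda^2}{\rho}+\frac{C_{\lambda,p}}{\rho}\Delta^2,\quad H_{\mathrm{det}}:=\overline\Phi_1+\frac{\Lambda^2}{2\rho},\quad \mathcal S_{\mathrm{det}}:=\{x\in\mathbb R^n:f(x)\le H_{\mathrm{det}},\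 \|c(x)\|\le2\Lambda/\rho\},$$ and $\mathcal N_r(S):=\{y\in\mathbb R^n:\operatorname{dist}(y,S)\le r\}$. Localization assumption: $\mathcal N_\Delta(\mathcal S_{\mathrm{det}})\subset\mathcal U$. For $k\ge1$, $\Phi_k:=\mathcal L_\rho(x_k,\lambda_k)+\frac{C_{\lambda,p}}{\rho}\|p_{k-1}\|^2$. *)

theory Defs
  imports "HOL-Analysis.Analysis"
begin

definition grad :: "(real^'n \<Rightarrow> real) \<Rightarrow> real^'n \<Rightarrow> real^'n" where
  "grad f x = (THE D. GDERIV f x :> D)"

text \<open>The \<open>n \<times> m\<close> matrix whose columns are the gradients of the components of \<open>c\<close>,
  that is, the transpose of the Jacobian.\<close>

definition nabla :: "(real^'n \<Rightarrow> real^'m) \<Rightarrow> real^'n \<Rightarrow> real^'m^'n" where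
  "nabla c x = (\<chi> i j. grad (\<lambda>y. c y $ j) x $ i)"

text \<open>The library norm on \<open>real^'m^'n\<close> is the Frobenius norm, hence the explicit operator norm.\<close>

definition spectral_norm :: "real^'m^'n \<Rightarrow> real" where
  "spectral_norm A = onorm ((*v) A)"

definition regularity ::
  "(real^'n \<Rightarrow> real) \<Rightarrow> (real^'n \<Rightarrow> real^'m) \<Rightarrow> (real^'n) set \<Rightarrow>
   real \<Rightarrow> real \<Rightarrow> real \<Rightarrow> real \<Rightarrow> real \<Rightarrow> real \<Rightarrow> bool" where
  "regularity f c U flow G Lf M Lc \<sigma> \<longleftrightarrow>
     open U \<and> U \<noteq> {} \<and>
     (\<forall>x\<in>U. f differentiable (at x)) \<and> continuous_on U (grad f) \<and>
     (\<forall>x\<in>U. c differentiable (at x)) \<and> continuous_on U (nabla c) \<and>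
     G > 0 \<and> Lf > 0 \<and> M > 0 \<and> Lc > 0 \<and> \<sigma> > 0 \<and>
     (\<forall>x\<in>U. f x \<ge> flow \<and> norm (grad f x) \<le> G) \<and>
     (\<forall>x\<in>U. \<forall>y\<in>U. norm (grad f x - grad f y) \<le> Lf * norm (x - y)) \<and>
     (\<forall>x\<in>U. spectral_norm (nabla c x) \<le> M) \<and>
     (\<forall>x\<in>U. \<forall>y\<in>U. spectral_norm (nabla c x - nabla c y) \<le> Lc * norm (x - y)) \<and>
     (\<forall>x\<in>U. \<forall>u. norm (nabla c x *v u) \<ge> \<sigma> * norm u)"

definition aug_lagrangian ::
  "(real^'n \<Rightarrow> real) \<Rightarrow> (real^'n \<Rightarrow> real^'m) \<Rightarrow> real \<Rightarrow> real^'n \<Rightarrow> real^'m \<Rightarrow> real" where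
  "aug_lagrangian f c \<rho> x lam = f x + lam \<bullet> c x + \<rho> / 2 * (norm (c x))\<^sup>2"

definition kappa_lin :: "real \<Rightarrow> real" where
  "kappa_lin Lc = Lc / 2"

definition C_mod :: "real \<Rightarrow> real \<Rightarrow> real \<Rightarrow> real \<Rightarrow> real \<Rightarrow> real \<Rightarrow> real" where
  "C_mod Lf M Lc \<rho> \<Delta> \<Lambda> =
     Lf / 2 + kappa_lin Lc * (3 * \<Lambda> + \<rho> * M * \<Delta>) + \<rho> / 2 * (kappa_lin Lc)\<^sup>2 * \<Delta>\<^sup>2"

definition A_p :: "real \<Rightarrow> real \<Rightarrow> real \<Rightarrow> real \<Rightarrow> real \<Rightarrow> real" where
  "A_p M Lc \<beta> \<rho> \<Delta> = \<beta> + \<rho> * M * kappa_lin Lc * \<Delta>"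

definition B_p :: "real \<Rightarrow> real \<Rightarrow> real \<Rightarrow> real \<Rightarrow> real \<Rightarrow> real \<Rightarrow> real \<Rightarrow> real" where
  "B_p Lf M Lc \<beta> \<rho> \<Delta> \<Lambda> = A_p M Lc \<beta> \<rho> \<Delta> + Lf + Lc * \<Lambda>"

definition C_lp :: "real \<Rightarrow> real \<Rightarrow> real \<Rightarrow> real \<Rightarrow> real \<Rightarrow> real \<Rightarrow> real \<Rightarrow> real \<Rightarrow> real" where
  "C_lp Lf M Lc \<sigma> \<beta> \<rho> \<Delta> \<Lambda> =
     4 / \<sigma>\<^sup>2 * max ((A_p M Lc \<beta> \<rho> \<Delta>)\<^sup>2) ((B_p Lf M Lc \<beta> \<rho> \<Delta> \<Lambda>)\<^sup>2)"

definition parameters ::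
  "(real^'n \<Rightarrow> real^'m) \<Rightarrow> real \<Rightarrow> real \<Rightarrow> real \<Rightarrow> real \<Rightarrow> real \<Rightarrow>
   real \<Rightarrow> real \<Rightarrow> real \<Rightarrow> real \<Rightarrow> real^'n \<Rightarrow> real^'m \<Rightarrow> bool" where
  "parameters c G Lf M Lc \<sigma> \<beta> \<rho> \<Delta> \<Lambda> x0 lam0 \<longleftrightarrow>
     \<beta> > 0 \<and> \<rho> > 0 \<and> \<Delta> > 0 \<and> \<Lambda> > 0 \<and>
     \<Lambda> \<ge> (G + \<beta> * \<Delta> + \<rho> * M * kappa_lin Lc * \<Delta>\<^sup>2) / \<sigma> \<and>
     G / \<beta> + 3 * M * \<Lambda> / (\<beta> + \<rho> * \<sigma>\<^sup>2) \<le> \<Delta> \<and>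
     C_mod Lf M Lc \<rho> \<Delta> \<Lambda> \<le> 3 * \<beta> / 8 \<and>
     \<rho> \<ge> 8 * C_lp Lf M Lc \<sigma> \<beta> \<rho> \<Delta> \<Lambda> / \<beta> \<and>
     norm lam0 \<le> \<Lambda> \<and> \<rho> * norm (c x0) \<le> \<Lambda>"

definition lalm_system ::
  "(real^'n \<Rightarrow> real) \<Rightarrow> (real^'n \<Rightarrow> real^'m) \<Rightarrow> real \<Rightarrow> real \<Rightarrow>
   real^'n \<Rightarrow> real^'m \<Rightarrow> real^'n \<Rightarrow> bool" where
  "lalm_system f c \<beta> \<rho> x lam p \<longleftrightarrow>
     (\<beta> *\<^sub>R mat 1 + \<rho> *\<^sub>R (nabla c x ** transpose (nabla c x))) *v p =
       - grad f x - nabla c x *v (lam + \<rho> *\<^sub>R c x)"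

definition lalm_dir ::
  "(real^'n \<Rightarrow> real) \<Rightarrow> (real^'n \<Rightarrow> real^'m) \<Rightarrow> real \<Rightarrow> real \<Rightarrow>
   real^'n \<Rightarrow> real^'m \<Rightarrow> real^'n" where
  "lalm_dir f c \<beta> \<rho> x lam = (THE p. lalm_system f c \<beta> \<rho> x lam p)"

primrec lalm_iter ::
  "(real^'n \<Rightarrow> real) \<Rightarrow> (real^'n \<Rightarrow> real^'m) \<Rightarrow> real \<Rightarrow> real \<Rightarrow>
   real^'n \<Rightarrow> real^'m \<Rightarrow> nat \<Rightarrow> (real^'n) \<times> (real^'m)" where
  "lalm_iter f c \<beta> \<rho> x0 lam0 0 = (x0, lam0)"
| "lalm_iter f c \<beta> \<rho> x0 lam0 (Suc k) =
     (let (x, lam) = lalm_iter f c \<beta> \<rho> x0 lam0 k;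
          x' = x + lalm_dir f c \<beta> \<rho> x lam
      in (x', lam + \<rho> *\<^sub>R c x'))"

text \<open>Since \<^const>\<open>grad\<close> and \<^const>\<open>lalm_dir\<close> are total, the iteration also runs through
  meaningless values. A step is well defined when the derivatives exist at the current
  point and the linear system has exactly one solution.\<close>

definition lalm_step_well_defined ::
  "(real^'n \<Rightarrow> real) \<Rightarrow> (real^'n \<Rightarrow> real^'m) \<Rightarrow> real \<Rightarrow> real \<Rightarrow>
   real^'n \<Rightarrow> real^'m \<Rightarrow> bool" where
  "lalm_step_well_defined f c \<beta> \<rho> x lam \<longleftrightarrow>
     f differentiable (at x) \<and> c differentiable (at x) \<and>
     (\<exists>!p. lalm_system f c \<beta> \<rho> x lam p)"

definition Phi1_bar ::
  "(real^'n \<Rightarrow> real) \<Rightarrow> real^'n \<Rightarrow> real \<Rightarrow> real \<Rightarrow> real \<Rightarrow> real \<Rightarrow> real \<Rightarrow>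
   real \<Rightarrow> real \<Rightarrow> real \<Rightarrow> real \<Rightarrow> real" where
  "Phi1_bar f x0 G Lf M Lc \<sigma> \<beta> \<rho> \<Delta> \<Lambda> =
     f x0 + G * \<Delta> + 4 * \<Lambda>\<^sup>2 / \<rho> + C_lp Lf M Lc \<sigma> \<beta> \<rho> \<Delta> \<Lambda> / \<rho> * \<Delta>\<^sup>2"

definition H_det ::
  "(real^'n \<Rightarrow> real) \<Rightarrow> real^'n \<Rightarrow> real \<Rightarrow> real \<Rightarrow> real \<Rightarrow> real \<Rightarrow> real \<Rightarrow>
   real \<Rightarrow> real \<Rightarrow> real \<Rightarrow> real \<Rightarrow> real" where
  "H_det f x0 G Lf M Lc \<sigma> \<beta> \<rho> \<Delta> \<Lambda> =
     Phi1_bar f x0 G Lf M Lc \<sigma> \<beta> \<rho> \<Delta> \<Lambda> + \<Lambda>\<^sup>2 / (2 * \<rho>)"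

definition S_det ::
  "(real^'n \<Rightarrow> real) \<Rightarrow> (real^'n \<Rightarrow> real^'m) \<Rightarrow> real^'n \<Rightarrow> real \<Rightarrow> real \<Rightarrow> real \<Rightarrow> real \<Rightarrow>
   real \<Rightarrow> real \<Rightarrow> real \<Rightarrow> real \<Rightarrow> real \<Rightarrow> (real^'n) set" where
  "S_det f c x0 G Lf M Lc \<sigma> \<beta> \<rho> \<Delta> \<Lambda> =
     {x. f x \<le> H_det f x0 G Lf M Lc \<sigma> \<beta> \<rho> \<Delta> \<Lambda> \<and> norm (c x) \<le> 2 * \<Lambda> / \<rho>}"

text \<open>\<^const>\<open>infdist\<close> to the empty set is \<open>0\<close> in the library; the convention here is
  \<open>dist(y, {}) = \<infinity>\<close>.\<close>

definition nbhd :: "real \<Rightarrow> 'a::metric_space set \<Rightarrow> 'a set" where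
  "nbhd r S = {y. S \<noteq> {} \<and> infdist y S \<le> r}"

end

theory Submission
  imports Defs
begin

text \<open>
  Write \<open>J\<^sub>k = \<nabla>c(x\<^sub>k)\<close> and let \<open>e\<^sub>k = c(x\<^sub>k + p\<^sub>k) - c(x\<^sub>k) - J\<^sub>k\<^sup>T p\<^sub>k\<close> be the linearization error,
  of size at most \<open>L\<^sub>c/2 \<parallel>p\<^sub>k\<parallel>\<^sup>2\<close>. The linear system says exactly that
  \<open>J\<^sub>k \<lambda>\<^sub>k\<^sub>+\<^sub>1 = - \<nabla>f(x\<^sub>k) - \<beta> p\<^sub>k + \<rho> J\<^sub>k e\<^sub>k\<close>. Since \<open>J\<^sub>k\<close> is bounded below by \<open>\<sigma>\<close>, this bounds
  \<open>\<lambda>\<^sub>k\<^sub>+\<^sub>1\<close> by \<open>\<Lambda>\<close>, and the difference of two consecutive such identities bounds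
  \<open>\<parallel>\<lambda>\<^sub>k\<^sub>+\<^sub>1 - \<lambda>\<^sub>k\<parallel>\<^sup>2\<close> by \<open>C/2 (\<parallel>p\<^sub>k\<parallel>\<^sup>2 + \<parallel>p\<^sub>k\<^sub>-\<^sub>1\<parallel>\<^sup>2)\<close>. The primal step decreases the augmented
  Lagrangian by \<open>5\<beta>/8 \<parallel>p\<^sub>k\<parallel>\<^sup>2\<close>, which absorbs the increase \<open>\<parallel>\<lambda>\<^sub>k\<^sub>+\<^sub>1 - \<lambda>\<^sub>k\<parallel>\<^sup>2/\<rho>\<close> of the multiplier
  update, so that \<open>\<Phi>\<^sub>k\<close> is nonincreasing. Completing the square, \<open>f \<le> \<Phi>\<^sub>k + \<Lambda>\<^sup>2/(2\<rho>)\<close> at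
  \<open>x\<^sub>k\<close>, so the iterates stay in the localization set and the induction closes.
\<close>

section \<open>Spectral norm and adjoint of a matrix\<close>

lemma norm_matrix_vector_mul_le: "norm (A *v u) \<le> spectral_norm A * norm u"
  unfolding spectral_norm_def by (rule onorm[OF matrix_vector_mul_bounded_linear])

lemma inner_transpose_vector_mul:
  fixes A :: "real^'m^'n"
  shows "(transpose A *v p) \<bullet> u = p \<bullet> (A *v u)"
  by (metis dot_lmul_matrix transpose_matrix_vector)

text \<open>Pair \<open>?v\<close> with itself, move the transpose across the inner product and
  cancel one factor \<open>norm ?v\<close>.\<close>

lemma norm_transpose_vector_mul_le:
  fixes A :: "real^'m^'n"
  shows "norm (transpose A *v p) \<le> spectral_norm A * norm p"
proof -
  let ?v = "transpose A *v p"
  have "norm ?v * norm ?v = p \<bullet> (A *v ?v)"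
    by (metis inner_transpose_vector_mul power2_eq_square power2_norm_eq_inner)
  also have "\<dots> \<le> norm p * (spectral_norm A * norm ?v)"
    by (meson norm_cauchy_schwarz norm_matrix_vector_mul_le mult_left_mono norm_ge_zero order_trans)
  finally have "norm ?v * norm ?v \<le> (spectral_norm A * norm p) * norm ?v"
    by (simp add: mult_ac)
  moreover have "0 \<le> spectral_norm A"
    unfolding spectral_norm_def by (rule onorm_pos_le[OF matrix_vector_mul_bounded_linear])
  ultimately show ?thesis
    by (cases "norm ?v = 0") (auto simp: mult_le_cancel_right)
qed

section \<open>Gradients, Jacobians and first-order Taylor remainders\<close>

lemma GDERIV_grad:
  fixes f :: "real^'n \<Rightarrow> real"
  assumes "f differentiable (at x)"
  shows "GDERIV f x :> grad f x"
proof -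
  from assms obtain D where D: "(f has_derivative D) (at x)"
    by (auto simp: differentiable_def)
  then have lin: "linear D"
    by (rule has_derivative_linear)
  \<comment> \<open>The Riesz vector of the derivative. Since \<open>grad\<close> is a definite
    description, uniqueness is needed besides this witness.\<close>
  let ?g = "\<Sum>i\<in>Basis. D i *\<^sub>R i"
  have "D h = ?g \<bullet> h" for h
  proof -
    have "D h = D (\<Sum>i\<in>Basis. (h \<bullet> i) *\<^sub>R i)"
      by (simp add: euclidean_representation)
    also have "\<dots> = ?g \<bullet> h"
      by (simp add: linear_sum[OF lin] linear_scale[OF lin] inner_sum_left inner_commute[of h] mult.commute)
    finally show ?thesis .
  qed
  then have "D = (\<lambda>h. h \<bullet> ?g)"
    by (intro ext) (metis inner_commute)
  with D have ex: "GDERIV f x :> ?g"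
    by (simp add: gderiv_def)
  have uniq: "E = ?g" if "GDERIV f x :> E" for E
  proof -
    have "(\<lambda>h. h \<bullet> E) = (\<lambda>h. h \<bullet> ?g)"
      using that ex unfolding gderiv_def by (rule has_derivative_unique)
    then have "(E - ?g) \<bullet> E = (E - ?g) \<bullet> ?g"
      by metis
    then have "(E - ?g) \<bullet> (E - ?g) = 0"
      by (simp add: inner_diff_right)
    then show ?thesis by simp
  qed
  show ?thesis
    unfolding grad_def by (rule theI) (use ex uniq in auto)
qed

lemma has_derivative_grad:
  fixes f :: "real^'n \<Rightarrow> real"
  assumes "f differentiable (at x)"
  shows "(f has_derivative (\<lambda>h. grad f x \<bullet> h)) (at x)"
  using GDERIV_grad[OF assms] by (simp add: gderiv_def inner_commute)

text \<open>Row by row the derivative is the gradient of a component of \<open>c\<close>;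
  \<open>nabla\<close> stores these gradients as columns, hence the transpose.\<close>

lemma has_derivative_nabla:
  fixes c :: "real^'n \<Rightarrow> real^'m"
  assumes "c differentiable (at x)"
  shows "(c has_derivative (\<lambda>h. transpose (nabla c x) *v h)) (at x)"
proof -
  from assms obtain D where D: "(c has_derivative D) (at x)"
    by (auto simp: differentiable_def)
  have "D h = transpose (nabla c x) *v h" for h
  proof (subst vec_eq_iff, intro allI)
    fix j
    have Dj: "((\<lambda>y. c y $ j) has_derivative (\<lambda>h. D h $ j)) (at x)"
      by (rule bounded_linear.has_derivative[OF bounded_linear_vec_nth D])
    then have "(\<lambda>y. c y $ j) differentiable (at x)"
      by (rule differentiableI)
    from has_derivative_unique[OF Dj has_derivative_grad[OF this]]
    have "D h $ j = grad (\<lambda>y. c y $ j) x \<bullet> h"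
      by metis
    also have "\<dots> = (transpose (nabla c x) *v h) $ j"
      by (simp add: matrix_vector_mult_def transpose_def nabla_def inner_vec_def)
    finally show "D h $ j = (transpose (nabla c x) *v h) $ j" .
  qed
  then have "D = (\<lambda>h. transpose (nabla c x) *v h)"
    by (rule ext)
  with D show ?thesis by metis
qed

text \<open>On the path \<open>x + t *\<^sub>R p\<close> the function \<open>h\<close> has
  derivative of norm at most \<open>L * (norm p)\<^sup>2 * t\<close>, and comparison with its
  antiderivative over [0,1] yields the factor 1/2. Testing derivatives only in direction
  \<open>p\<close> lets one statement serve both \<open>f\<close> and \<open>c\<close>.\<close>

lemma linearization_error_le:
  fixes F :: "'a::real_normed_vector \<Rightarrow> 'b::real_normed_vector"
  assumes der: "\<And>y. y \<in> closed_segment x (x + p) \<Longrightarrow> (F has_derivative F' y) (at y)"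
    and lip: "\<And>y. y \<in> closed_segment x (x + p) \<Longrightarrow> norm (F' y p - F' x p) \<le> L * norm (y - x) * norm p"
  shows "norm (F (x + p) - F x - F' x p) \<le> L / 2 * (norm p)\<^sup>2"
proof -
  define h where "h = (\<lambda>t::real. F (x + t *\<^sub>R p) - t *\<^sub>R F' x p)"
  have mem: "x + t *\<^sub>R p \<in> closed_segment x (x + p)" if "0 \<le> t" "t \<le> 1" for t
    using that by (auto simp: in_segment algebra_simps intro!: exI[of _ t])
  have h': "(h has_vector_derivative (F' (x + t *\<^sub>R p) p - F' x p)) (at t)"
    if "0 \<le> t" "t \<le> 1" for t
  proof -
    have F: "(F has_derivative F' (x + t *\<^sub>R p)) (at (x + t *\<^sub>R p))"
      using der mem that by blast
    have "((\<lambda>t. x + t *\<^sub>R p) has_derivative (\<lambda>s. s *\<^sub>R p)) (at t)"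
      by (auto intro!: derivative_eq_intros)
    from has_derivative_compose[OF this F]
    have "((\<lambda>t. F (x + t *\<^sub>R p)) has_derivative (\<lambda>s. s *\<^sub>R F' (x + t *\<^sub>R p) p)) (at t)"
      by (simp add: linear_scale[OF has_derivative_linear[OF F]])
    then show ?thesis
      unfolding h_def has_vector_derivative_def
      by (auto intro!: derivative_eq_intros simp: scaleR_diff_right)
  qed
  have "norm (h 1 - h 0) \<le> L * (norm p)\<^sup>2 * 1\<^sup>2 / 2 - L * (norm p)\<^sup>2 * 0\<^sup>2 / 2"
  proof (rule differentiable_bound_general
      [where \<phi> = "\<lambda>t. L * (norm p)\<^sup>2 * t\<^sup>2 / 2" and \<phi>' = "\<lambda>t. L * (norm p)\<^sup>2 * t"])
    show "continuous_on {0..1} h"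
      by (rule continuous_on_vector_derivative) (use h' in \<open>auto intro: has_vector_derivative_at_within\<close>)
    show "(h has_vector_derivative (F' (x + t *\<^sub>R p) p - F' x p)) (at t)" if "0 < t" "t < 1" for t
      using h' that by simp
    show "((\<lambda>t. L * (norm p)\<^sup>2 * t\<^sup>2 / 2) has_vector_derivative L * (norm p)\<^sup>2 * t) (at t)" for t :: real
      by (auto intro!: derivative_eq_intros simp flip: has_real_derivative_iff_has_vector_derivative)
    show "norm (F' (x + t *\<^sub>R p) p - F' x p) \<le> L * (norm p)\<^sup>2 * t" if "0 < t" "t < 1" for t
      using lip[OF mem, of t] that by (simp add: power2_eq_square mult_ac)
  qed (auto intro!: continuous_intros)
  then show ?thesis
    by (simp add: h_def algebra_simps)
qed

section \<open>Coercive linear systems\<close>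

lemma norm_le_of_coercive:
  fixes u :: "'a::real_inner"
  assumes "\<mu> * (norm u)\<^sup>2 \<le> u \<bullet> v" "0 < \<mu>"
  shows "norm u \<le> norm v / \<mu>"
proof (cases "u = 0")
  case False
  have "\<mu> * (norm u)\<^sup>2 \<le> norm u * norm v"
    using assms(1) norm_cauchy_schwarz order_trans by blast
  then have "\<mu> * norm u \<le> norm v"
    using False by (simp add: power2_eq_square mult.left_commute)
  then show ?thesis
    using assms(2) by (simp add: field_simps)
qed (use assms in auto)

text \<open>Lax-Milgram in finite dimension: coercivity makes the kernel trivial, and an injective
  linear endomorphism is onto.\<close>

lemma coercive_linear_bij:
  fixes T :: "'a::euclidean_space \<Rightarrow> 'a"
  assumes "linear T" "\<And>u. \<mu> * (norm u)\<^sup>2 \<le> u \<bullet> T u" "0 < \<mu>"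
  shows "\<exists>!u. T u = v"
proof -
  have "inj T"
    unfolding linear_injective_0[OF assms(1)]
  proof (intro allI impI)
    fix u
    assume "T u = 0"
    with norm_le_of_coercive[OF assms(2) assms(3), of u] show "u = 0"
      by simp
  qed
  then have "surj T"
    by (rule linear_injective_imp_surjective[OF assms(1)]) (rule refl)
  with \<open>inj T\<close> show ?thesis
    by (metis injD surjD)
qed

lemma regularized_normal_ex1:
  fixes J :: "real^'m^'n"
  assumes "0 < \<beta>" "0 < \<rho>"
  shows "\<exists>!p. \<beta> *\<^sub>R p + \<rho> *\<^sub>R (J *v (transpose J *v p)) = v"
proof (rule coercive_linear_bij[OF _ _ assms(1)])
  show "linear (\<lambda>p. \<beta> *\<^sub>R p + \<rho> *\<^sub>R (J *v (transpose J *v p)))"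
    by (intro linearI) (simp_all add: algebra_simps matrix_vector_right_distrib matrix_vector_mult_scaleR)
  show "\<beta> * (norm u)\<^sup>2 \<le> u \<bullet> (\<beta> *\<^sub>R u + \<rho> *\<^sub>R (J *v (transpose J *v u)))" for u
    using assms
    by (simp add: inner_add_right flip: inner_transpose_vector_mul power2_norm_eq_inner)
qed

text \<open>The push-through identity
  \<open>(\<beta> I + \<rho> J J\<^sup>T)\<^sup>-\<^sup>1 J = J (\<beta> I + \<rho> J\<^sup>T J)\<^sup>-\<^sup>1\<close> is what makes \<open>\<sigma>\<close> help in the second term.\<close>

lemma regularized_normal_norm_le:
  fixes J :: "real^'m^'n"
  assumes pos: "0 < \<beta>" "0 < \<rho>" and M: "spectral_norm J \<le> M"
    and \<sigma>: "0 < \<sigma>" "\<And>u. \<sigma> * norm u \<le> norm (J *v u)"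
    and eq: "\<beta> *\<^sub>R p + \<rho> *\<^sub>R (J *v (transpose J *v p)) = - g - J *v w"
  shows "norm p \<le> norm g / \<beta> + M * norm w / (\<beta> + \<rho> * \<sigma>\<^sup>2)"
proof -
  have \<mu>: "0 < \<beta> + \<rho> * \<sigma>\<^sup>2"
    using pos by (simp add: add_pos_nonneg)
  \<comment> \<open>The companion operator on the multiplier space. There the lower bound on
    \<open>J\<close> raises the coercivity constant from \<open>\<beta>\<close> to
    \<open>\<beta> + \<rho> * \<sigma>\<^sup>2\<close>.\<close>
  let ?T = "\<lambda>q. \<beta> *\<^sub>R q + \<rho> *\<^sub>R (transpose J *v (J *v q))"
  have coercive: "(\<beta> + \<rho> * \<sigma>\<^sup>2) * (norm q)\<^sup>2 \<le> q \<bullet> ?T q" for q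
  proof -
    have "(\<sigma> * norm q)\<^sup>2 \<le> (norm (J *v q))\<^sup>2"
      using \<sigma> by (intro power_mono) auto
    then have "\<rho> * (\<sigma>\<^sup>2 * (norm q)\<^sup>2) \<le> \<rho> * (norm (J *v q))\<^sup>2"
      using pos by (simp add: power_mult_distrib)
    moreover have "q \<bullet> (transpose J *v (J *v q)) = (norm (J *v q))\<^sup>2"
      by (metis inner_commute inner_transpose_vector_mul power2_norm_eq_inner)
    moreover have "q \<bullet> q = (norm q)\<^sup>2"
      by (simp add: power2_norm_eq_inner)
    ultimately show ?thesis
      by (simp add: inner_add_right algebra_simps)
  qed
  have "linear ?T"
    by (intro linearI) (simp_all add: algebra_simps matrix_vector_right_distrib matrix_vector_mult_scaleR)
  from coercive_linear_bij[OF this coercive \<mu>] obtain q where q: "?T q = w"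
    by metis
  have nq: "norm q \<le> norm w / (\<beta> + \<rho> * \<sigma>\<^sup>2)"
    by (rule norm_le_of_coercive[OF _ \<mu>]) (use coercive[of q] q in simp)
  \<comment> \<open>By push-through, \<open>- (J *v q)\<close> solves the system with right-hand
    side \<open>- (J *v w)\<close>. The rest \<open>r\<close> answers to \<open>- g\<close> alone,
    where coercivity with constant \<open>\<beta>\<close> suffices.\<close>
  define r where "r = p + J *v q"
  have "J *v w = \<beta> *\<^sub>R (J *v q) + \<rho> *\<^sub>R (J *v (transpose J *v (J *v q)))"
    unfolding q[symmetric]
    by (simp add: matrix_vector_right_distrib matrix_vector_mult_scaleR)
  with eq have r: "\<beta> *\<^sub>R r + \<rho> *\<^sub>R (J *v (transpose J *v r)) = - g"
    unfolding r_def by (simp add: matrix_vector_right_distrib algebra_simps)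
  have "r \<bullet> (J *v (transpose J *v r)) = (norm (transpose J *v r))\<^sup>2"
    by (metis inner_transpose_vector_mul power2_norm_eq_inner)
  then have "r \<bullet> (- g) = \<beta> * (norm r)\<^sup>2 + \<rho> * (norm (transpose J *v r))\<^sup>2"
    unfolding r[symmetric] by (simp add: inner_add_right power2_norm_eq_inner)
  then have "norm r \<le> norm (- g) / \<beta>"
    using pos by (intro norm_le_of_coercive) auto
  moreover have "norm (J *v q) \<le> M * (norm w / (\<beta> + \<rho> * \<sigma>\<^sup>2))"
  proof -
    have "norm (J *v q) \<le> M * norm q"
      by (meson M norm_matrix_vector_mul_le mult_right_mono norm_ge_zero order_trans)
    moreover have "0 \<le> M"
      using M onorm_pos_le[OF matrix_vector_mul_bounded_linear[of J]] by (simp add: spectral_norm_def)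
    ultimately show ?thesis
      by (meson nq mult_left_mono order_trans)
  qed
  moreover have "norm p \<le> norm r + norm (J *v q)"
    unfolding r_def by (metis add_diff_cancel_right' norm_triangle_ineq4)
  ultimately show ?thesis by simp
qed

section \<open>Standing assumptions, localization and Taylor bounds\<close>

locale nr_lalm =
  fixes f :: "real^'n \<Rightarrow> real" and c :: "real^'n \<Rightarrow> real^'m" and U :: "(real^'n) set"
    and flow G Lf M Lc \<sigma> \<beta> \<rho> \<Delta> \<Lambda> :: real
    and x0 :: "real^'n" and lam0 :: "real^'m"
  assumes regularity: "regularity f c U flow G Lf M Lc \<sigma>"
    and parameters: "parameters c G Lf M Lc \<sigma> \<beta> \<rho> \<Delta> \<Lambda> x0 lam0"
    and localization: "nbhd \<Delta> (S_det f c x0 G Lf M Lc \<sigma> \<beta> \<rho> \<Delta> \<Lambda>) \<subseteq> U"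
begin

abbreviation "g \<equiv> grad f"
abbreviation "J \<equiv> nabla c"
abbreviation "\<kappa> \<equiv> kappa_lin Lc"
abbreviation "A \<equiv> A_p M Lc \<beta> \<rho> \<Delta>"
abbreviation "B \<equiv> B_p Lf M Lc \<beta> \<rho> \<Delta> \<Lambda>"
abbreviation "C \<equiv> C_lp Lf M Lc \<sigma> \<beta> \<rho> \<Delta> \<Lambda>"
abbreviation "\<Phi>\<^sub>1 \<equiv> Phi1_bar f x0 G Lf M Lc \<sigma> \<beta> \<rho> \<Delta> \<Lambda>"
abbreviation "S \<equiv> S_det f c x0 G Lf M Lc \<sigma> \<beta> \<rho> \<Delta> \<Lambda>"
abbreviation "system \<equiv> lalm_system f c \<beta> \<rho>"
abbreviation "\<L> \<equiv> aug_lagrangian f c \<rho>"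

definition err :: "real^'n \<Rightarrow> real^'n \<Rightarrow> real^'m" where
  "err x p = c (x + p) - c x - transpose (J x) *v p"

lemma pos [simp]:
  "0 < G" "0 < Lf" "0 < M" "0 < Lc" "0 < \<sigma>" "0 < \<beta>" "0 < \<rho>" "0 < \<Delta>" "0 < \<Lambda>" "0 < \<kappa>"
  using regularity parameters
  unfolding regularity_def parameters_def kappa_lin_def by simp_all

lemma nonneg [simp]: "0 \<le> M" "0 \<le> \<rho>" "0 \<le> \<beta>" "0 \<le> \<Delta>" "0 \<le> \<Lambda>" "0 \<le> \<kappa>" "0 \<le> A" "0 \<le> B" "0 \<le> C"
  unfolding A_p_def B_p_def C_lp_def using pos by (simp_all add: less_imp_le le_max_iff_disj)

lemma differentiable: "x \<in> U \<Longrightarrow> f differentiable (at x)" "x \<in> U \<Longrightarrow> c differentiable (at x)"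
  using regularity unfolding regularity_def by auto

lemma norm_g_le: "x \<in> U \<Longrightarrow> norm (g x) \<le> G"
  and norm_g_diff_le: "x \<in> U \<Longrightarrow> y \<in> U \<Longrightarrow> norm (g x - g y) \<le> Lf * norm (x - y)"
  and spectral_norm_J_le: "x \<in> U \<Longrightarrow> spectral_norm (J x) \<le> M"
  and spectral_norm_J_diff_le: "x \<in> U \<Longrightarrow> y \<in> U \<Longrightarrow> spectral_norm (J x - J y) \<le> Lc * norm (x - y)"
  and J_bounded_below: "x \<in> U \<Longrightarrow> \<sigma> * norm u \<le> norm (J x *v u)"
  using regularity unfolding regularity_def by auto

lemma norm_J_mul_le: "x \<in> U \<Longrightarrow> norm (J x *v u) \<le> M * norm u"
  and norm_transpose_J_mul_le: "x \<in> U \<Longrightarrow> norm (transpose (J x) *v p) \<le> M * norm p"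
  by (meson spectral_norm_J_le norm_matrix_vector_mul_le norm_transpose_vector_mul_le
      mult_right_mono norm_ge_zero order_trans)+

lemma norm_J_diff_mul_le: "x \<in> U \<Longrightarrow> y \<in> U \<Longrightarrow> norm ((J x - J y) *v u) \<le> Lc * norm (x - y) * norm u"
  and norm_transpose_J_diff_mul_le:
    "x \<in> U \<Longrightarrow> y \<in> U \<Longrightarrow> norm (transpose (J x - J y) *v p) \<le> Lc * norm (x - y) * norm p"
  by (meson spectral_norm_J_diff_le norm_matrix_vector_mul_le norm_transpose_vector_mul_le
      mult_right_mono norm_ge_zero order_trans)+

text \<open>Each point of the segment is within \<open>norm p\<close> of \<open>x\<close>, hence
  within \<open>\<Delta>\<close> of \<open>S\<close>. This opens the whole segment to the derivative
  bounds on \<open>U\<close>.\<close>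

lemma segment_subset_U:
  assumes "x \<in> S" "norm p \<le> \<Delta>"
  shows "closed_segment x (x + p) \<subseteq> U"
proof
  fix y
  assume y: "y \<in> closed_segment x (x + p)"
  have "infdist y S \<le> dist y x"
    using assms(1) by (rule infdist_le)
  also have "\<dots> \<le> norm p"
    using segment_bound1[OF y] by (simp add: dist_norm)
  finally show "y \<in> U"
    using assms localization unfolding nbhd_def by fastforce
qed

lemma S_subset_U: "x \<in> S \<Longrightarrow> x \<in> U"
  using segment_subset_U[of x 0] by simp

lemma norm_err_le:
  assumes "x \<in> S" "norm p \<le> \<Delta>"
  shows "norm (err x p) \<le> \<kappa> * (norm p)\<^sup>2"
  unfolding err_def kappa_lin_def
proof (rule linearization_error_le)
  fix y
  assume "y \<in> closed_segment x (x + p)"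
  then have y: "y \<in> U"
    using segment_subset_U[OF assms] by blast
  then show "(c has_derivative (\<lambda>h. transpose (J y) *v h)) (at y)"
    by (intro has_derivative_nabla differentiable)
  have "transpose (J y) *v p - transpose (J x) *v p = transpose (J y - J x) *v p"
    by (simp only: matrix_vector_mult_diff_rdistrib[symmetric]) (simp add: transpose_def vec_eq_iff matrix_vector_mult_def)
  then show "norm (transpose (J y) *v p - transpose (J x) *v p) \<le> Lc * norm (y - x) * norm p"
    using norm_transpose_J_diff_mul_le y S_subset_U[OF assms(1)] by metis
qed

lemma f_step_le:
  assumes "x \<in> S" "norm p \<le> \<Delta>"
  shows "f (x + p) \<le> f x + g x \<bullet> p + Lf / 2 * (norm p)\<^sup>2"
proof -
  have "norm (f (x + p) - f x - g x \<bullet> p) \<le> Lf / 2 * (norm p)\<^sup>2"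
  proof (rule linearization_error_le)
    fix y
    assume "y \<in> closed_segment x (x + p)"
    then have y: "y \<in> U"
      using segment_subset_U[OF assms] by blast
    then show "(f has_derivative (\<lambda>h. g y \<bullet> h)) (at y)"
      by (intro has_derivative_grad differentiable)
    have "norm (g y \<bullet> p - g x \<bullet> p) \<le> norm (g y - g x) * norm p"
      by (metis Cauchy_Schwarz_ineq2 inner_diff_left real_norm_def)
    also have "\<dots> \<le> Lf * norm (y - x) * norm p"
      using norm_g_diff_le[OF y S_subset_U[OF assms(1)]] by (simp add: mult_right_mono)
    finally show "norm (g y \<bullet> p - g x \<bullet> p) \<le> Lf * norm (y - x) * norm p" .
  qed
  then show ?thesis
    unfolding real_norm_def by linarith
qed

text \<open>The mean value inequality with the gradient bound. It supplies the term
  \<open>G * \<Delta>\<close> of \<open>\<Phi>\<^sub>1\<close>.\<close>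

lemma f_step_le_Lipschitz:
  assumes "x \<in> S" "norm p \<le> \<Delta>"
  shows "f (x + p) \<le> f x + G * \<Delta>"
proof -
  have "norm (f (x + p) - f x) \<le> G * norm ((x + p) - x)"
  proof (rule differentiable_bound[of "closed_segment x (x + p)"])
    fix y
    assume "y \<in> closed_segment x (x + p)"
    then have y: "y \<in> U"
      using segment_subset_U[OF assms] by blast
    then show "(f has_derivative (\<lambda>h. g y \<bullet> h)) (at y within closed_segment x (x + p))"
      by (intro has_derivative_at_withinI[OF has_derivative_grad] differentiable)
    show "onorm (\<lambda>h. g y \<bullet> h) \<le> G"
    proof (rule onorm_le)
      show "norm (g y \<bullet> h) \<le> G * norm h" for h
        using Cauchy_Schwarz_ineq2[of "g y" h] norm_g_le[OF y]
        by (simp add: order_trans[OF _ mult_right_mono])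
    qed
  qed auto
  also have "\<dots> \<le> G * \<Delta>"
    using assms(2) by simp
  finally show ?thesis by (simp add: abs_le_iff)
qed

section \<open>The linear system, step length and multiplier bounds\<close>

lemma system_iff:
  "system x lam p \<longleftrightarrow>
    \<beta> *\<^sub>R p + \<rho> *\<^sub>R (J x *v (transpose (J x) *v p)) = - g x - J x *v (lam + \<rho> *\<^sub>R c x)"
  unfolding lalm_system_def
  by (simp add: matrix_vector_mult_add_rdistrib scaleR_matrix_vector_assoc[symmetric] matrix_vector_mul_assoc
      del: transpose_matrix_vector)

lemma system_ex1: "\<exists>!p. system x lam p"
  unfolding system_iff by (rule regularized_normal_ex1) simp_all

lemma system_lalm_dir: "system x lam (lalm_dir f c \<beta> \<rho> x lam)"
  unfolding lalm_dir_def by (rule theI'[OF system_ex1])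

text \<open>One \<open>\<Lambda>\<close> comes from \<open>lam\<close>, two from the constraint
  bound in \<open>S\<close>. This is the origin of \<open>3 * \<Lambda>\<close> in the second
  parameter inequality and in \<open>C_mod\<close>.\<close>

lemma norm_shifted_multiplier_le:
  assumes "x \<in> S" "norm lam \<le> \<Lambda>"
  shows "norm (lam + \<rho> *\<^sub>R c x) \<le> 3 * \<Lambda>"
proof -
  have "\<rho> * norm (c x) \<le> 2 * \<Lambda>"
    using assms(1) by (simp add: S_det_def pos_le_divide_eq mult.commute)
  then show ?thesis
    using norm_triangle_ineq[of lam "\<rho> *\<^sub>R c x"] assms(2) by simp
qed

text \<open>Only data at \<open>x\<close> enter, so the step is bounded before anything is known at
  \<open>x + p\<close>; there is no circularity with the localization.\<close>

lemma norm_step_le: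
  assumes "x \<in> S" "norm lam \<le> \<Lambda>" "system x lam p"
  shows "norm p \<le> \<Delta>"
proof -
  note U = S_subset_U[OF assms(1)]
  have "norm p \<le> norm (g x) / \<beta> + M * norm (lam + \<rho> *\<^sub>R c x) / (\<beta> + \<rho> * \<sigma>\<^sup>2)"
    by (rule regularized_normal_norm_le[where J = "J x"])
      (use assms(3) U in \<open>auto simp: system_iff spectral_norm_J_le J_bounded_below\<close>)
  also have "\<dots> \<le> G / \<beta> + M * (3 * \<Lambda>) / (\<beta> + \<rho> * \<sigma>\<^sup>2)"
    using norm_g_le[OF U] norm_shifted_multiplier_le[OF assms(1,2)]
    by (intro add_mono divide_right_mono mult_left_mono) auto
  also have "\<dots> \<le> \<Delta>"
    using parameters unfolding parameters_def by (simp add: mult_ac)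
  finally show ?thesis .
qed

text \<open>Replace \<open>c x\<close> plus its linear increment by
  \<open>c (x + p) - err x p\<close> in the system; the updated multiplier appears.\<close>

lemma multiplier_eq:
  assumes "system x lam p"
  shows "J x *v (lam + \<rho> *\<^sub>R c (x + p)) = - g x - \<beta> *\<^sub>R p + \<rho> *\<^sub>R (J x *v err x p)"
proof -
  have g: "- g x = \<beta> *\<^sub>R p + \<rho> *\<^sub>R (J x *v (transpose (J x) *v p)) + J x *v (lam + \<rho> *\<^sub>R c x)"
    using assms unfolding system_iff by (rule diff_eq_eq[THEN iffD1, OF sym])
  show ?thesis
    unfolding err_def g
    by (simp only: matrix_vector_right_distrib matrix_vector_mult_diff_distrib
        matrix_vector_mult_scaleR scaleR_diff_right) simp
qed

text \<open>One factor \<open>norm p\<close> of the quadratic remainder is traded for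
  \<open>\<Delta>\<close>, which leaves a bound linear in the step.\<close>

lemma norm_J_err_le:
  assumes "x \<in> S" "norm p \<le> \<Delta>"
  shows "norm (\<rho> *\<^sub>R (J x *v err x p)) \<le> \<rho> * M * \<kappa> * \<Delta> * norm p"
proof -
  have "norm (J x *v err x p) \<le> M * (\<kappa> * (norm p)\<^sup>2)"
    by (rule order_trans[OF norm_J_mul_le[OF S_subset_U[OF assms(1)]]])
      (simp add: norm_err_le[OF assms])
  also have "\<dots> \<le> M * (\<kappa> * (\<Delta> * norm p))"
    using assms(2) by (simp add: power2_eq_square mult_right_mono)
  finally show ?thesis
    by (simp add: mult_ac)
qed

text \<open>In \<open>multiplier_eq\<close> the old multiplier acts only through the step length, so
  the same \<open>\<Lambda>\<close> is reproduced. The three terms add up to the first parameter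
  inequality times \<open>\<sigma>\<close>.\<close>

lemma norm_multiplier_le:
  assumes "x \<in> S" "norm lam \<le> \<Lambda>" "system x lam p"
  shows "norm (lam + \<rho> *\<^sub>R c (x + p)) \<le> \<Lambda>"
proof -
  note U = S_subset_U[OF assms(1)] and p = norm_step_le[OF assms]
  let ?mu = "lam + \<rho> *\<^sub>R c (x + p)"
  have "\<sigma> * norm ?mu \<le> norm (J x *v ?mu)"
    by (rule J_bounded_below[OF U])
  also have "\<dots> \<le> norm (g x) + norm (\<beta> *\<^sub>R p) + norm (\<rho> *\<^sub>R (J x *v err x p))"
  proof -
    have "norm (- a - b + d) \<le> norm a + norm b + norm d" for a b d :: "real^'n"
      using norm_triangle_ineq[of "- a - b" d] norm_triangle_ineq4[of "- a" b] by simp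
    then show ?thesis
      unfolding multiplier_eq[OF assms(3)] .
  qed
  also have "\<dots> \<le> G + \<beta> * \<Delta> + \<rho> * M * \<kappa> * \<Delta> * \<Delta>"
  proof (intro add_mono)
    show "norm (\<rho> *\<^sub>R (J x *v err x p)) \<le> \<rho> * M * \<kappa> * \<Delta> * \<Delta>"
      by (rule order_trans[OF norm_J_err_le[OF assms(1) p]]) (use p in \<open>intro mult_left_mono; simp\<close>)
  qed (use norm_g_le[OF U] p in auto)
  also have "\<dots> \<le> \<sigma> * \<Lambda>"
    using parameters unfolding parameters_def
    by (simp add: pos_divide_le_eq power2_eq_square mult_ac)
  finally show ?thesis by simp
qed

text \<open>\<open>\<rho> *\<^sub>R c (x + p)\<close> is the difference of two multipliers of norm
  at most \<open>\<Lambda>\<close>; this explains the radius in \<open>S\<close>.\<close>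

lemma norm_c_step_le:
  assumes "x \<in> S" "norm lam \<le> \<Lambda>" "system x lam p"
  shows "norm (c (x + p)) \<le> 2 * \<Lambda> / \<rho>"
proof -
  have "norm (\<rho> *\<^sub>R c (x + p)) \<le> 2 * \<Lambda>"
    using norm_multiplier_le[OF assms] assms(2) norm_triangle_ineq4[of "lam + \<rho> *\<^sub>R c (x + p)" lam]
    by simp
  then show ?thesis
    by (simp add: pos_le_divide_eq mult.commute)
qed

section \<open>Primal decrease and multiplier increments\<close>

lemma primal_descent:
  assumes "x \<in> S" "norm lam \<le> \<Lambda>" "system x lam p"
  shows "\<L> (x + p) lam \<le> \<L> x lam - 5 * \<beta> / 8 * (norm p)\<^sup>2"
proof -
  note U = S_subset_U[OF assms(1)] and p = norm_step_le[OF assms]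
  define d where "d = transpose (J x) *v p"
  define e where "e = err x p"
  define w where "w = lam + \<rho> *\<^sub>R c x"
  have c: "c (x + p) = c x + d + e"
    by (simp add: d_def e_def err_def)
  \<comment> \<open>Exact expansion around the linearized constraint \<open>c x + d\<close>, with
    every contribution of the remainder \<open>e\<close> in the last bracket.\<close>
  have model: "\<L> (x + p) lam - \<L> x lam =
      (f (x + p) - f x) + w \<bullet> d + \<rho> / 2 * (norm d)\<^sup>2 + ((w + \<rho> *\<^sub>R d) \<bullet> e + \<rho> / 2 * (norm e)\<^sup>2)"
    unfolding aug_lagrangian_def c w_def power2_norm_eq_inner
    by (simp add: inner_add_left inner_add_right inner_commute[of d "c x"] inner_commute[of e "c x"]
        inner_commute[of e d] distrib_left)
  have "(J x *v d) \<bullet> p = (norm d)\<^sup>2" "w \<bullet> d = p \<bullet> (J x *v w)"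
    unfolding d_def
    by (simp_all only: inner_commute[of w] inner_commute[of _ p] power2_norm_eq_inner
        inner_transpose_vector_mul)
  moreover have "p \<bullet> (\<beta> *\<^sub>R p + \<rho> *\<^sub>R (J x *v d)) = p \<bullet> (- g x - J x *v w)"
    using assms(3) unfolding system_iff d_def w_def by (simp only:)
  \<comment> \<open>The system paired with \<open>p\<close>. Together with
    \<open>\<rho> / 2 * (norm d)\<^sup>2\<close> from the model, the \<open>d\<close> terms leave a
    nonpositive amount that is dropped.\<close>
  ultimately have stat: "g x \<bullet> p + w \<bullet> d = - \<beta> * (norm p)\<^sup>2 - \<rho> * (norm d)\<^sup>2"
    by (simp add: inner_add_right inner_diff_right power2_norm_eq_inner inner_commute)
  have e: "norm e \<le> \<kappa> * (norm p)\<^sup>2"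
    unfolding e_def by (rule norm_err_le[OF assms(1) p])
  have "norm d \<le> M * norm p"
    unfolding d_def by (rule norm_transpose_J_mul_le[OF U])
  also have "\<dots> \<le> M * \<Delta>"
    using p by simp
  finally have "norm (\<rho> *\<^sub>R d) \<le> \<rho> * M * \<Delta>"
    by simp
  with norm_shifted_multiplier_le[OF assms(1,2)]
  have "norm (w + \<rho> *\<^sub>R d) \<le> 3 * \<Lambda> + \<rho> * M * \<Delta>"
    unfolding w_def by (rule norm_triangle_mono)
  then have we: "(w + \<rho> *\<^sub>R d) \<bullet> e \<le> (3 * \<Lambda> + \<rho> * M * \<Delta>) * (\<kappa> * (norm p)\<^sup>2)"
    by (intro order_trans[OF norm_cauchy_schwarz] mult_mono e) simp_all
  have "(norm e)\<^sup>2 \<le> (\<kappa> * (norm p)\<^sup>2)\<^sup>2"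
    using e by (simp add: power_mono)
  also have "\<dots> = \<kappa>\<^sup>2 * ((norm p)\<^sup>2 * (norm p)\<^sup>2)"
    by (simp add: power_mult_distrib power2_eq_square)
  also have "\<dots> \<le> \<kappa>\<^sup>2 * (\<Delta>\<^sup>2 * (norm p)\<^sup>2)"
    using p by (intro mult_left_mono mult_right_mono power_mono) auto
  finally have "\<rho> / 2 * (norm e)\<^sup>2 \<le> \<rho> / 2 * (\<kappa>\<^sup>2 * (\<Delta>\<^sup>2 * (norm p)\<^sup>2))"
    by simp
  moreover have "f (x + p) - f x \<le> g x \<bullet> p + Lf / 2 * (norm p)\<^sup>2"
    using f_step_le[OF assms(1) p] by simp
  moreover have "0 \<le> \<rho> / 2 * (norm d)\<^sup>2"
    by simp
  \<comment> \<open>\<open>C_mod\<close> collects the curvature of \<open>f\<close> and the linear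
    and quadratic effects of \<open>e\<close>. Being at most \<open>3 * \<beta> / 8\<close>, it
    leaves \<open>5 * \<beta> / 8\<close> of the decrease \<open>\<beta>\<close>.\<close>
  moreover have "C_mod Lf M Lc \<rho> \<Delta> \<Lambda> * (norm p)\<^sup>2 =
      Lf / 2 * (norm p)\<^sup>2 + (3 * \<Lambda> + \<rho> * M * \<Delta>) * (\<kappa> * (norm p)\<^sup>2) + \<rho> / 2 * (\<kappa>\<^sup>2 * (\<Delta>\<^sup>2 * (norm p)\<^sup>2))"
    unfolding C_mod_def by (simp add: algebra_simps)
  moreover have "C_mod Lf M Lc \<rho> \<Delta> \<Lambda> * (norm p)\<^sup>2 \<le> 3 * \<beta> / 8 * (norm p)\<^sup>2"
    using parameters unfolding parameters_def by (intro mult_right_mono) auto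
  ultimately show ?thesis
    using model stat we by argo
qed

text \<open>Subtract \<open>multiplier_eq\<close> at two consecutive points and use the lower bound
  on \<open>J\<close> at the later one. Here \<open>p\<close> is the earlier step and
  \<open>q\<close> the later.\<close>

lemma multiplier_difference_le:
  assumes x: "x \<in> S" "norm lam \<le> \<Lambda>" "system x lam p"
    and mu: "mu = lam + \<rho> *\<^sub>R c (x + p)"
    and y: "x + p \<in> S" "system (x + p) mu q"
  shows "(norm (\<rho> *\<^sub>R c (x + p + q)))\<^sup>2 \<le> C / 2 * ((norm q)\<^sup>2 + (norm p)\<^sup>2)"
proof -
  let ?y = "x + p" and ?d = "\<rho> *\<^sub>R c (x + p + q)"
  have nmu: "norm mu \<le> \<Lambda>"
    unfolding mu by (rule norm_multiplier_le[OF x])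
  note U = S_subset_U[OF x(1)] S_subset_U[OF y(1)]
    and p = norm_step_le[OF x] and q = norm_step_le[OF y(1) nmu y(2)]
  \<comment> \<open>The identity for \<open>mu\<close> involves the Jacobian at \<open>x\<close>, so
    passing to \<open>?y\<close> costs the term \<open>(J ?y - J x) *v mu\<close>.\<close>
  have "J ?y *v ?d = J ?y *v (mu + ?d) - J x *v mu - (J ?y - J x) *v mu"
    by (simp add: matrix_vector_right_distrib matrix_vector_mult_diff_rdistrib)
  also have "\<dots> = - (g ?y - g x) - \<beta> *\<^sub>R q + \<beta> *\<^sub>R p
      + \<rho> *\<^sub>R (J ?y *v err ?y q) - \<rho> *\<^sub>R (J x *v err x p) - (J ?y - J x) *v mu"
    unfolding multiplier_eq[OF y(2)] multiplier_eq[OF x(3), folded mu] by simp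
  also have "norm \<dots> \<le> norm (g ?y - g x) + norm (\<beta> *\<^sub>R q) + norm (\<beta> *\<^sub>R p)
      + norm (\<rho> *\<^sub>R (J ?y *v err ?y q)) + norm (\<rho> *\<^sub>R (J x *v err x p)) + norm ((J ?y - J x) *v mu)"
  proof -
    have "norm (- a - b + d + e - h - i) \<le> norm a + norm b + norm d + norm e + norm h + norm i"
      for a b d e h i :: "real^'n"
      using norm_triangle_ineq4[of "- a - b + d + e - h" i] norm_triangle_ineq4[of "- a - b + d + e" h]
        norm_triangle_ineq[of "- a - b + d" e] norm_triangle_ineq[of "- a - b" d]
        norm_triangle_ineq4[of "- a" b]
      by simp
    then show ?thesis .
  qed
  also have "\<dots> \<le> Lf * norm p + \<beta> * norm q + \<beta> * norm p
      + \<rho> * M * \<kappa> * \<Delta> * norm q + \<rho> * M * \<kappa> * \<Delta> * norm p + Lc * norm p * \<Lambda>"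
  proof (intro add_mono)
    show "norm (g ?y - g x) \<le> Lf * norm p"
      using norm_g_diff_le[OF U(2,1)] by simp
    have "norm ((J ?y - J x) *v mu) \<le> Lc * norm p * norm mu"
      using norm_J_diff_mul_le[OF U(2,1)] by simp
    also have "\<dots> \<le> Lc * norm p * \<Lambda>"
      using nmu by (intro mult_left_mono) (auto simp: less_imp_le)
    finally show "norm ((J ?y - J x) *v mu) \<le> Lc * norm p * \<Lambda>" .
  qed (use norm_J_err_le[OF x(1) p] norm_J_err_le[OF y(1) q] in auto)
  \<comment> \<open>\<open>B\<close> exceeds \<open>A\<close> by the variation of the gradient and
    of the Jacobian across the step \<open>p\<close>.\<close>
  also have "\<dots> = A * norm q + B * norm p"
    unfolding A_p_def B_p_def by (simp add: algebra_simps)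
  finally have "\<sigma> * norm ?d \<le> A * norm q + B * norm p"
    using J_bounded_below[OF U(2), of ?d] by linarith
  then have "(\<sigma> * norm ?d)\<^sup>2 \<le> (A * norm q + B * norm p)\<^sup>2"
    by (rule power_mono) (simp add: less_imp_le)
  \<comment> \<open>From \<open>(a - b)\<^sup>2 \<ge> 0\<close>. This factor 2 is half of the 4 in
    \<open>C\<close>, hence \<open>C / 2\<close> in the conclusion.\<close>
  also have "\<dots> \<le> 2 * (A\<^sup>2 * (norm q)\<^sup>2) + 2 * (B\<^sup>2 * (norm p)\<^sup>2)"
    using sum_squares_ge_zero[of "A * norm q - B * norm p" 0]
    by (simp add: power2_eq_square algebra_simps)
  also have "\<dots> \<le> 2 * (max (A\<^sup>2) (B\<^sup>2) * (norm q)\<^sup>2) + 2 * (max (A\<^sup>2) (B\<^sup>2) * (norm p)\<^sup>2)"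
    by (intro add_mono mult_left_mono mult_right_mono) auto
  also have "\<dots> = 4 * max (A\<^sup>2) (B\<^sup>2) / 2 * ((norm q)\<^sup>2 + (norm p)\<^sup>2)"
    by (simp add: distrib_left)
  also have "4 * max (A\<^sup>2) (B\<^sup>2) = \<sigma>\<^sup>2 * C"
    unfolding C_lp_def using less_imp_neq[OF pos(5)] by simp
  also have "\<sigma>\<^sup>2 * C / 2 * ((norm q)\<^sup>2 + (norm p)\<^sup>2) = \<sigma>\<^sup>2 * (C / 2 * ((norm q)\<^sup>2 + (norm p)\<^sup>2))"
    by simp
  finally show ?thesis
    using pos(5) by (simp add: power_mult_distrib)
qed

section \<open>The potential: link to \<open>f\<close>, initial bound and monotonicity\<close>

lemma aug_lagrangian_multiplier_update: "\<L> x (lam + \<rho> *\<^sub>R c x) = \<L> x lam + (norm (\<rho> *\<^sub>R c x))\<^sup>2 / \<rho>"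
  using pos(7) unfolding aug_lagrangian_def
  by (simp add: inner_add_left power_mult_distrib power2_eq_square flip: power2_norm_eq_inner)

text \<open>The multiplier and penalty terms equal
  \<open>(norm (lam + \<rho> *\<^sub>R c x))\<^sup>2 / (2 * \<rho>)\<close> minus
  \<open>(norm lam)\<^sup>2 / (2 * \<rho>)\<close>. This loss is the gap between
  \<open>\<Phi>\<^sub>1\<close> and \<open>H_det\<close>.\<close>

lemma f_le_aug_lagrangian:
  assumes "norm lam \<le> \<Lambda>"
  shows "f x \<le> \<L> x lam + \<Lambda>\<^sup>2 / (2 * \<rho>)"
proof -
  have "0 \<le> (norm (lam + \<rho> *\<^sub>R c x))\<^sup>2"
    by simp
  also have "\<dots> = (norm lam)\<^sup>2 + 2 * \<rho> * (lam \<bullet> c x + \<rho> / 2 * (norm (c x))\<^sup>2)"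
    unfolding power2_norm_eq_inner
    by (simp add: inner_add_left inner_add_right inner_commute algebra_simps)
  also have "\<dots> \<le> \<Lambda>\<^sup>2 + 2 * \<rho> * (\<L> x lam - f x)"
    using assms by (simp add: aug_lagrangian_def power_mono)
  finally have "f x - \<L> x lam \<le> \<Lambda>\<^sup>2 / (2 * \<rho>)"
    using pos(7) by (subst pos_le_divide_eq) (simp_all add: algebra_simps)
  then show ?thesis by simp
qed

lemma mem_S:
  assumes "norm lam \<le> \<Lambda>" "\<L> x lam + C / \<rho> * (norm p)\<^sup>2 \<le> \<Phi>\<^sub>1" "norm (c x) \<le> 2 * \<Lambda> / \<rho>"
  shows "x \<in> S"
proof -
  have "0 \<le> C / \<rho> * (norm p)\<^sup>2"
    by simp
  then have "f x \<le> H_det f x0 G Lf M Lc \<sigma> \<beta> \<rho> \<Delta> \<Lambda>"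
    using assms(2) f_le_aug_lagrangian[OF assms(1), of x] unfolding H_det_def by linarith
  with assms(3) show ?thesis
    unfolding S_det_def by simp
qed

lemma x0_mem_S: "x0 \<in> S"
proof -
  have "0 \<le> G * \<Delta>" "0 \<le> 4 * \<Lambda>\<^sup>2 / \<rho>" "0 \<le> C / \<rho> * \<Delta>\<^sup>2" "0 \<le> \<Lambda>\<^sup>2 / (2 * \<rho>)"
    by (simp_all add: less_imp_le)
  then have "f x0 \<le> H_det f x0 G Lf M Lc \<sigma> \<beta> \<rho> \<Delta> \<Lambda>"
    unfolding H_det_def Phi1_bar_def by linarith
  moreover have "\<rho> * norm (c x0) \<le> 2 * \<Lambda>"
    using parameters pos(9) unfolding parameters_def by linarith
  ultimately show ?thesis
    by (simp add: S_det_def pos_le_divide_eq mult.commute)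
qed

lemma norm_lam0_le: "norm lam0 \<le> \<Lambda>"
  using parameters unfolding parameters_def by blast

text \<open>No previous step exists, so each term is bounded directly; the multiplier and penalty
  terms contribute \<open>2 * \<Lambda>\<^sup>2 / \<rho>\<close> each.\<close>

lemma potential_initial_le:
  assumes "system x0 lam0 p" and mu: "mu = lam0 + \<rho> *\<^sub>R c (x0 + p)"
  shows "\<L> (x0 + p) mu + C / \<rho> * (norm p)\<^sup>2 \<le> \<Phi>\<^sub>1"
proof -
  note step = x0_mem_S norm_lam0_le assms(1)
  have c: "norm (c (x0 + p)) \<le> 2 * \<Lambda> / \<rho>" and p: "norm p \<le> \<Delta>"
    using norm_c_step_le[OF step] norm_step_le[OF step] .
  have "mu \<bullet> c (x0 + p) \<le> norm mu * norm (c (x0 + p))"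
    by (rule norm_cauchy_schwarz)
  also have "\<dots> \<le> \<Lambda> * (2 * \<Lambda> / \<rho>)"
    using norm_multiplier_le[OF step] c unfolding mu by (intro mult_mono) auto
  finally have "mu \<bullet> c (x0 + p) \<le> 2 * \<Lambda>\<^sup>2 / \<rho>"
    by (simp add: power2_eq_square mult_ac)
  moreover have "\<rho> / 2 * (norm (c (x0 + p)))\<^sup>2 \<le> 2 * \<Lambda>\<^sup>2 / \<rho>"
  proof -
    have "\<rho> / 2 * (norm (c (x0 + p)))\<^sup>2 \<le> \<rho> / 2 * (2 * \<Lambda> / \<rho>)\<^sup>2"
      using c by (intro mult_left_mono power_mono) auto
    then show ?thesis
      using pos(7) by (simp add: power_divide power2_eq_square)
  qed
  moreover have "C / \<rho> * (norm p)\<^sup>2 \<le> C / \<rho> * \<Delta>\<^sup>2"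
    using p by (intro mult_left_mono power_mono) auto
  ultimately show ?thesis
    using f_step_le_Lipschitz[OF x0_mem_S p] unfolding aug_lagrangian_def Phi1_bar_def
    by (simp add: add_divide_distrib[symmetric])
qed

text \<open>The multiplier update costs \<open>(?Q + ?P) / 2\<close>. The stored \<open>?P\<close>
  pays its own half; since \<open>?Q\<close> is at most
  \<open>\<beta> / 8 * (norm q)\<^sup>2\<close>, the primal decrease, five times that bound, covers
  the remaining \<open>3/2 * ?Q\<close>.\<close>

lemma potential_decreasing:
  assumes x: "x \<in> S" "norm lam \<le> \<Lambda>" "system x lam p"
    and mu: "mu = lam + \<rho> *\<^sub>R c (x + p)"
    and y: "x + p \<in> S" "system (x + p) mu q"
    and nu: "nu = mu + \<rho> *\<^sub>R c (x + p + q)"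
  shows "\<L> (x + p + q) nu + C / \<rho> * (norm q)\<^sup>2 \<le> \<L> (x + p) mu + C / \<rho> * (norm p)\<^sup>2"
proof -
  have nmu: "norm mu \<le> \<Lambda>"
    unfolding mu by (rule norm_multiplier_le[OF x])
  let ?P = "C / \<rho> * (norm p)\<^sup>2" and ?Q = "C / \<rho> * (norm q)\<^sup>2"
  have "(norm (\<rho> *\<^sub>R c (x + p + q)))\<^sup>2 / \<rho> \<le> C / 2 * ((norm q)\<^sup>2 + (norm p)\<^sup>2) / \<rho>"
    by (intro divide_right_mono multiplier_difference_le[OF x mu y]) simp
  also have "\<dots> = (?Q + ?P) / 2"
    by (simp add: add_divide_distrib distrib_left)
  finally have dual: "\<L> (x + p + q) nu \<le> \<L> (x + p + q) mu + (?Q + ?P) / 2"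
    unfolding nu aug_lagrangian_multiplier_update by simp
  have "C / \<rho> \<le> \<beta> / 8"
    using parameters unfolding parameters_def by (simp add: field_simps)
  then have "?Q \<le> \<beta> / 8 * (norm q)\<^sup>2"
    by (rule mult_right_mono) simp
  moreover have "0 \<le> \<beta> / 8 * (norm q)\<^sup>2" "0 \<le> ?P" "0 \<le> ?Q"
    by simp_all
  moreover have "\<L> (x + p + q) mu \<le> \<L> (x + p) mu - 5 * (\<beta> / 8 * (norm q)\<^sup>2)"
    using primal_descent[OF y(1) nmu y(2)] by simp
  ultimately show ?thesis
    using dual by argo
qed

section \<open>The iterates and the closing induction\<close>

abbreviation "x k \<equiv> fst (lalm_iter f c \<beta> \<rho> x0 lam0 k)"
abbreviation "lam k \<equiv> snd (lalm_iter f c \<beta> \<rho> x0 lam0 k)"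
abbreviation "p k \<equiv> lalm_dir f c \<beta> \<rho> (x k) (lam k)"

lemma iter_Suc: "x (Suc k) = x k + p k" "lam (Suc k) = lam k + \<rho> *\<^sub>R c (x k + p k)"
  by (simp_all add: Let_def case_prod_beta)

text \<open>The potential is taken at \<open>Suc k\<close>, where a previous step \<open>p k\<close>
  exists; its bound is what yields membership of the next iterate in \<open>S\<close>.\<close>

lemma invariant:
  "x k \<in> S \<and> norm (lam k) \<le> \<Lambda> \<and>
    \<L> (x (Suc k)) (lam (Suc k)) + C / \<rho> * (norm (p k))\<^sup>2 \<le> \<Phi>\<^sub>1"
proof (induction k)
  case 0
  show ?case
    using x0_mem_S norm_lam0_le potential_initial_le[OF system_lalm_dir refl]
    unfolding iter_Suc by simp
next
  case (Suc k)
  then have k: "x k \<in> S" "norm (lam k) \<le> \<Lambda>" "system (x k) (lam k) (p k)"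
    and \<Phi>: "\<L> (x (Suc k)) (lam (Suc k)) + C / \<rho> * (norm (p k))\<^sup>2 \<le> \<Phi>\<^sub>1"
    by (simp_all only: system_lalm_dir)
  have lam: "norm (lam (Suc k)) \<le> \<Lambda>"
    unfolding iter_Suc(2) by (rule norm_multiplier_le[OF k])
  have "norm (c (x (Suc k))) \<le> 2 * \<Lambda> / \<rho>"
    unfolding iter_Suc(1) by (rule norm_c_step_le[OF k])
  \<comment> \<open>Membership comes from the potential bound already known at this iterate, and
    only then may the estimates be applied to the step leaving it.\<close>
  from mem_S[OF lam \<Phi> this] have S: "x (Suc k) \<in> S" .
  have "\<L> (x (Suc (Suc k))) (lam (Suc (Suc k))) + C / \<rho> * (norm (p (Suc k)))\<^sup>2
      \<le> \<L> (x (Suc k)) (lam (Suc k)) + C / \<rho> * (norm (p k))\<^sup>2"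
    using potential_decreasing[OF k iter_Suc(2) S[unfolded iter_Suc(1)]
        system_lalm_dir[of "x (Suc k)" "lam (Suc k)", unfolded iter_Suc(1)[of k]] refl]
    by (simp only: iter_Suc(1)[symmetric] iter_Suc(2)[of "Suc k"])
  with \<Phi> S lam show ?case
    by linarith
qed

end

theorem theorem2p10:
  fixes f :: "real^'n \<Rightarrow> real" and c :: "real^'n \<Rightarrow> real^'m"
    and U :: "(real^'n) set"
    and flow G Lf M Lc \<sigma> \<beta> \<rho> \<Delta> \<Lambda> :: real
    and x0 :: "real^'n" and lam0 :: "real^'m"
    and x p :: "nat \<Rightarrow> real^'n" and lam :: "nat \<Rightarrow> real^'m" and \<Phi> :: "nat \<Rightarrow> real"
  assumes "regularity f c U flow G Lf M Lc \<sigma>"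
    and "parameters c G Lf M Lc \<sigma> \<beta> \<rho> \<Delta> \<Lambda> x0 lam0"
    and "nbhd \<Delta> (S_det f c x0 G Lf M Lc \<sigma> \<beta> \<rho> \<Delta> \<Lambda>) \<subseteq> U"
  defines "x \<equiv> \<lambda>k. fst (lalm_iter f c \<beta> \<rho> x0 lam0 k)"
    and "lam \<equiv> \<lambda>k. snd (lalm_iter f c \<beta> \<rho> x0 lam0 k)"
    and "p \<equiv> \<lambda>k. lalm_dir f c \<beta> \<rho> (x k) (lam k)"
    and "\<Phi> \<equiv> \<lambda>k. aug_lagrangian f c \<rho> (x k) (lam k)
                 + C_lp Lf M Lc \<sigma> \<beta> \<rho> \<Delta> \<Lambda> / \<rho> * (norm (p (k - 1)))\<^sup>2"
  shows "(\<forall>k. lalm_step_well_defined f c \<beta> \<rho> (x k) (lam k)) \<and>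
         (\<forall>k. closed_segment (x k) (x (Suc k)) \<subseteq> U) \<and>
         (\<forall>k. norm (p k) \<le> \<Delta> \<and> norm (lam k) \<le> \<Lambda> \<and>
              x k \<in> S_det f c x0 G Lf M Lc \<sigma> \<beta> \<rho> \<Delta> \<Lambda>) \<and>
         (\<forall>k\<ge>1. \<Phi> k \<le> Phi1_bar f x0 G Lf M Lc \<sigma> \<beta> \<rho> \<Delta> \<Lambda>)"
proof -
  interpret nr_lalm f c U flow G Lf M Lc \<sigma> \<beta> \<rho> \<Delta> \<Lambda> x0 lam0
    using assms(1-3) by unfold_locales
  have S: "x k \<in> S" and lam: "norm (lam k) \<le> \<Lambda>"
    and pot: "\<L> (x (Suc k)) (lam (Suc k)) + C / \<rho> * (norm (p k))\<^sup>2 \<le> \<Phi>\<^sub>1" for k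
    using invariant[of k] unfolding x_def lam_def p_def by blast+
  have p: "norm (p k) \<le> \<Delta>" for k
    using norm_step_le[OF S lam system_lalm_dir] unfolding p_def .
  have "lalm_step_well_defined f c \<beta> \<rho> (x k) (lam k)" for k
    unfolding lalm_step_well_defined_def
    using differentiable S_subset_U[OF S] system_ex1 by blast
  moreover have "closed_segment (x k) (x (Suc k)) \<subseteq> U" for k
    using segment_subset_U[OF S p, of k k] iter_Suc(1)[of k] unfolding x_def lam_def p_def by simp
  moreover have "\<Phi> k \<le> \<Phi>\<^sub>1" if "k \<ge> 1" for k
    \<comment> \<open>For \<open>k \<ge> 1\<close> the truncated subtraction is exact, so
      \<open>Suc (k - 1)\<close> is \<open>k\<close>.\<close>
    using pot[of "k - 1"] that unfolding \<Phi>_def by simp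
  ultimately show ?thesis
    using S lam p by blast
qed

end
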